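(* Let $A$ be a real $n\times p$ matrix, $y\in\mathbb{R}^n$, $t>0$, and $F(x)=\|x\|_1+\frac{\|Ax-y\|^2}{2t}$ for $x\in\mathbb{R}^p$. Let $\hat x$ be a minimizer of $F$ over $\mathbb{R}^p$, and let $\xi=\frac{A^*(y-A\hat x)}{t}$, $I_0=\{i\in\{1,\dots,p\}:\hat x_i=0\}$, $\partial I_0=\{i\in I_0:|\xi_i|=1\}$ and $S=\{1,\dots,p\}\setminus I_0$. For $T>0$ let $X_T=(X_{T,i})_{i=1}^p$ be a random vector in $\mathbb{R}^p$ with probability density proportional to $x\mapsto\exp(-\frac1T F(x))$. Suppose that the matrix $[\langle Ae_i,Ae_j\rangle]_{i,j\in S\cup\partial I_0}$ is invertible. Then, as $T\to0$, the random vector $$\Big(\Big(\frac{X_{T,i}}{T}\Big)_{i\in I_0\setminus\partial I_0},\ \Big(\frac{X_{T,i}-\hat x_i}{\sqrt T}\Big)_{i\in S\cup\partial I_0}\Big)$$ converges in distribution to the random vector $\big((X_i)_{i\in I_0\setminus\partial I_0},(X_i)_{i\in S\cup\partial I_0}\big)$ whose probability density on $\mathbb{R}^p$ is proportional to $$\prod_{i\in I_0\setminus\partial I_0}\exp\big(-|x_i|(1-\mathrm{sgn}(x_i)\xi_i)\big)\cdot\exp\Big(-\frac{\big\|\sum_{i\in S\cup\partial I_0}x_iAe_i\big\|^2}{2t}\Big)\prod_{i\in\partial I_0}\mathbf{1}_{[\mathrm{sgn}(x_i)\xi_i=1]}.$$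
   Context: $\|\cdot\|$ is the Euclidean norm, $\|x\|_1=\sum_{i=1}^p|x_i|$, $\langle\cdot,\cdot\rangle$ is the Euclidean scalar product, $A^*$ is the transpose of $A$, and $(e_i)_{i=1}^p$ is the canonical basis of $\mathbb{R}^p$. For a real number $s$, $\mathrm{sgn}(s)=1$ if $s>0$, $\mathrm{sgn}(s)=-1$ if $s<0$, and $\mathrm{sgn}(0)$ is any element of $[-1,1]$ (any fixed choice; the set where some $x_i=0$ is Lebesgue-null). $T\to0$ means $T\downarrow0$. (An empty matrix is regarded as invertible, and empty products equal $1$.) *)

theory Defs
  imports "HOL-Probability.Probability"
begin

definition l1_norm :: "real ^ 'p \<Rightarrow> real" where
  "l1_norm x = (\<Sum>i\<in>UNIV. \<bar>x $ i\<bar>)"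

definition lasso_objective :: "real ^ 'p ^ 'n \<Rightarrow> real ^ 'n \<Rightarrow> real \<Rightarrow> real ^ 'p \<Rightarrow> real" where
  "lasso_objective A y t x = l1_norm x + (norm (A *v x - y))\<^sup>2 / (2 * t)"

definition lasso_xi :: "real ^ 'p ^ 'n \<Rightarrow> real ^ 'n \<Rightarrow> real \<Rightarrow> real ^ 'p \<Rightarrow> real ^ 'p" where
  "lasso_xi A y t xhat = (transpose A *v (y - A *v xhat)) /\<^sub>R t"

definition zero_set :: "real ^ 'p \<Rightarrow> 'p set" where
  "zero_set xhat = {i. xhat $ i = 0}"

definition bdry_zero_set :: "real ^ 'p \<Rightarrow> real ^ 'p \<Rightarrow> 'p set" where
  "bdry_zero_set xhat \<xi> = {i \<in> zero_set xhat. \<bar>\<xi> $ i\<bar> = 1}"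

definition supp_set :: "real ^ 'p \<Rightarrow> 'p set" where
  "supp_set xhat = UNIV - zero_set xhat"

(* The value s0 at 0 is a parameter, since the sign of 0 is an arbitrary element of [-1,1]. *)
definition sgn_at0 :: "real \<Rightarrow> real \<Rightarrow> real" where
  "sgn_at0 s0 s = (if s > 0 then 1 else if s < 0 then - 1 else s0)"

(* Invertibility of the square matrix (M i j), i and j in J, for a finite index set J:
   there is a two-sided inverse, as in the library's invertible, whose index sets are types.
   The empty matrix (J = {}) is invertible. *)
definition invertible_on :: "'i set \<Rightarrow> ('i \<Rightarrow> 'i \<Rightarrow> real) \<Rightarrow> bool" where
  "invertible_on J M \<longleftrightarrow>
     (\<exists>B. (\<forall>i\<in>J. \<forall>j\<in>J. (\<Sum>k\<in>J. M i k * B k j) = (if i = j then 1 else 0)) \<and>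
          (\<forall>i\<in>J. \<forall>j\<in>J. (\<Sum>k\<in>J. B i k * M k j) = (if i = j then 1 else 0)))"

definition has_density_proportional_to ::
  "'w measure \<Rightarrow> ('w \<Rightarrow> 'b :: euclidean_space) \<Rightarrow> ('b \<Rightarrow> real) \<Rightarrow> bool" where
  "has_density_proportional_to M X g \<longleftrightarrow>
     (\<exists>c>0. distributed M lborel X (\<lambda>x. ennreal (c * g x)))"

(* Convergence in distribution along a filter F (expectations of bounded continuous functions
   converge); the library's weak_conv_m only covers real-valued random variables.
   The variables X T may live on different probability spaces M T. *)
definition converges_in_distribution ::
  "('t \<Rightarrow> 'w measure) \<Rightarrow> ('t \<Rightarrow> 'w \<Rightarrow> 'b :: topological_space) \<Rightarrow>
   'v measure \<Rightarrow> ('v \<Rightarrow> 'b) \<Rightarrow> 't filter \<Rightarrow> bool" where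
  "converges_in_distribution M X N Z F \<longleftrightarrow>
     (\<forall>f :: 'b \<Rightarrow> real. continuous_on UNIV f \<longrightarrow> bounded (range f) \<longrightarrow>
        ((\<lambda>T. \<integral>\<omega>. f (X T \<omega>) \<partial>M T) \<longlongrightarrow> (\<integral>\<omega>. f (Z \<omega>) \<partial>N)) F)"

(* Coordinates in I0 - bdry(I0) are scaled by T, the remaining ones centred and scaled by sqrt T;
   the two blocks are kept in one vector indexed by 'p. *)
definition rescaled :: "real ^ 'p \<Rightarrow> real ^ 'p \<Rightarrow> real \<Rightarrow> real ^ 'p \<Rightarrow> real ^ 'p" where
  "rescaled xhat \<xi> T x =
     (\<chi> i. if i \<in> zero_set xhat - bdry_zero_set xhat \<xi> then x $ i / T
           else (x $ i - xhat $ i) / sqrt T)"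

definition limit_weight ::
  "real \<Rightarrow> real ^ 'p ^ 'n \<Rightarrow> real \<Rightarrow> real ^ 'p \<Rightarrow> real ^ 'p \<Rightarrow> real ^ 'p \<Rightarrow> real" where
  "limit_weight s0 A t xhat \<xi> x =
     (\<Prod>i\<in>zero_set xhat - bdry_zero_set xhat \<xi>.
        exp (- \<bar>x $ i\<bar> * (1 - sgn_at0 s0 (x $ i) * \<xi> $ i))) *
     exp (- (norm (\<Sum>i\<in>supp_set xhat \<union> bdry_zero_set xhat \<xi>. x $ i *\<^sub>R (A *v axis i 1)))\<^sup>2
            / (2 * t)) *
     (\<Prod>i\<in>bdry_zero_set xhat \<xi>. of_bool (sgn_at0 s0 (x $ i) * \<xi> $ i = 1))"

end

theory Submission
  imports Defs
begin

text \<open>Put \<open>J = I\<^sub>0 - \<partial>I\<^sub>0\<close> and \<open>K = S \<union> \<partial>I\<^sub>0\<close>, and substitute \<open>x\<^sub>i = T z\<^sub>i\<close> for \<open>i \<in> J\<close> and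
  \<open>x\<^sub>i = xhat\<^sub>i + sqrt T z\<^sub>i\<close> for \<open>i \<in> K\<close>. The rescaled variable then has a density proportional to
  \<open>exp (- energy T z)\<close> with \<open>energy T z = (F x - F xhat) / T\<close>; normalising constants and the Jacobian
  cancel. Expanding \<open>F\<close> at its minimiser gives
  \<open>(\<Sum>i\<in>J. \<bar>z\<^sub>i\<bar> - \<xi>\<^sub>i z\<^sub>i) + (\<Sum>i\<in>K. slack i (sqrt T z\<^sub>i) / T) + \<parallel>sqrt T u + v\<parallel>\<^sup>2 / (2 t)\<close>,
  where \<open>u\<close> and \<open>v\<close> are the images under \<open>A\<close> of the two blocks of \<open>z\<close>, and optimality makes every
  \<open>slack\<close> nonnegative. As \<open>T\<close> tends to 0, the slack terms of \<open>S\<close> vanish, those of \<open>\<partial>I\<^sub>0\<close> are either 0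
  or blow up, and \<open>sqrt T u\<close> disappears. Invertibility of the Gram matrix on \<open>K\<close> gives
  a bound \<open>exp (- energy T z) \<le> C exp (- a \<parallel>z\<parallel>\<^sub>1)\<close> uniform in \<open>T \<le> 1\<close>, so dominated convergence applies.\<close>

section \<open>Coordinatewise integration and measurability\<close>

lemma Basis_real_vec: "(Basis :: (real ^ 'p) set) = range (\<lambda>i. axis i 1)"
  by (auto simp: Basis_vec_def)

lemma inj_axis_one: "inj (\<lambda>i::'p::finite. axis i (1::real))"
  by (auto simp: inj_def axis_eq_axis)

lemma borel_measurable_vec_nth [measurable]: "(\<lambda>x::real ^ 'p. x $ i) \<in> borel_measurable borel"
  by (intro borel_measurable_continuous_onI continuous_intros)

text \<open>Transfers the affine substitution for \<open>lborel\<close>, whose scale factors are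
  attached to basis vectors, to factors indexed by coordinates, along the bijection from
  \<open>i\<close> to \<open>axis i 1\<close>. The two blocks of coordinates will be scaled
  differently.\<close>

lemma integral_lborel_affine_vec:
  fixes c :: "'p::finite \<Rightarrow> real" and g :: "real ^ 'p \<Rightarrow> real"
  assumes c: "\<And>i. c i \<noteq> 0" and [measurable]: "g \<in> borel_measurable borel"
  shows "(\<integral>x. g x \<partial>lborel) = (\<Prod>i\<in>UNIV. \<bar>c i\<bar>) * (\<integral>x. g (a + (\<chi> i. c i * x $ i)) \<partial>lborel)"
proof -
  define d where "d b = c (inv (\<lambda>i. axis i (1::real)) b)" for b
  have d [simp]: "d (axis i 1) = c i" for i
    unfolding d_def by (subst inv_f_f[OF inj_axis_one]) simp
  define S where "S x = a + (\<Sum>j\<in>Basis. (d j * (x \<bullet> j)) *\<^sub>R j)" for x :: "real ^ 'p"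
  have S: "S x = a + (\<chi> i. c i * x $ i)" for x
  proof -
    have "(\<Sum>j\<in>Basis. (d j * (x \<bullet> j)) *\<^sub>R j) = (\<Sum>i\<in>UNIV. (c i * x $ i) *\<^sub>R axis i 1)"
      by (simp add: Basis_real_vec sum.reindex inj_axis_one inner_axis)
    also have "\<dots> = (\<chi> i. c i * x $ i)"
      using basis_expansion[of "\<chi> i. c i * x $ i"] by (simp add: scalar_mult_eq_scaleR)
    finally show ?thesis by (simp add: S_def)
  qed
  have [measurable]: "S \<in> borel_measurable borel"
    unfolding S_def[abs_def] by simp
  have prod: "(\<Prod>j\<in>Basis. \<bar>d j\<bar>) = (\<Prod>i\<in>UNIV. \<bar>c i\<bar>)"
    by (simp add: Basis_real_vec prod.reindex inj_axis_one)
  have lb: "(lborel :: (real ^ 'p) measure) = density (distr lborel borel S) (\<lambda>_. ennreal (\<Prod>i\<in>UNIV. \<bar>c i\<bar>))"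
    unfolding prod[symmetric] S_def
    by (rule lborel_affine_euclidean) (use c in \<open>auto simp: Basis_real_vec\<close>)
  have "(\<integral>x. g x \<partial>lborel) = (\<integral>x. g x \<partial>density (distr lborel borel S) (\<lambda>_. ennreal (\<Prod>i\<in>UNIV. \<bar>c i\<bar>)))"
    using lb by simp
  also have "\<dots> = (\<integral>x. (\<Prod>i\<in>UNIV. \<bar>c i\<bar>) * g (S x) \<partial>lborel)"
    by (subst integral_real_density) (auto simp: integral_distr prod_nonneg)
  finally show ?thesis by (simp add: S)
qed

lemma nn_integral_exp_abs_finite:
  fixes a :: real
  assumes "a > 0"
  shows "(\<integral>\<^sup>+x. ennreal (exp (- a * \<bar>x\<bar>)) \<partial>lborel) < \<infinity>"
proof -
  let ?h = "\<lambda>x::real. ennreal (exp (- x)) * indicator {0..} x"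
  have h: "(\<integral>\<^sup>+x. ?h x \<partial>lborel) = 1"
    using nn_intergal_power_times_exp_Ici[of 0] by simp
  have aff: "(\<integral>\<^sup>+x. ?h (c * x) \<partial>lborel) < \<infinity>" if "c \<noteq> 0" for c
  proof -
    have "ennreal \<bar>c\<bar> * (\<integral>\<^sup>+x. ?h (c * x) \<partial>lborel) = 1"
      using nn_integral_real_affine[of ?h c 0] that h by simp
    then show ?thesis
      using that by (cases "(\<integral>\<^sup>+x. ?h (c * x) \<partial>lborel) = \<infinity>") (auto simp: ennreal_mult_top less_top)
  qed
  \<comment> \<open>One half-line exponential for each sign of \<open>x\<close>; at 0 both terms
    count, hence only an inequality.\<close>
  have "(\<integral>\<^sup>+x. ennreal (exp (- a * \<bar>x\<bar>)) \<partial>lborel) \<le> (\<integral>\<^sup>+x. ?h (a * x) + ?h (- a * x) \<partial>lborel)"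
    using assms
    by (intro nn_integral_mono) (auto simp: indicator_def zero_le_mult_iff mult_le_0_iff abs_if)
  also have "\<dots> = (\<integral>\<^sup>+x. ?h (a * x) \<partial>lborel) + (\<integral>\<^sup>+x. ?h (- a * x) \<partial>lborel)"
    by (subst nn_integral_add) auto
  also have "\<dots> < \<infinity>"
    using aff[of a] aff[of "- a"] assms by simp
  finally show ?thesis .
qed

lemma continuous_on_l1_norm: "continuous_on S l1_norm"
  unfolding l1_norm_def[abs_def] by (intro continuous_intros)

lemma borel_measurable_l1_norm [measurable]: "l1_norm \<in> borel_measurable borel"
  by (intro borel_measurable_continuous_onI continuous_on_l1_norm)

text \<open>The integrand is a product of functions of single coordinates, so the integral
  factorises into one-dimensional ones. A multiple of this function dominates all rescaled weights
  below.\<close>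

lemma integrable_exp_l1_norm:
  assumes "a > 0"
  shows "integrable lborel (\<lambda>x :: real ^ 'p. exp (- a * l1_norm x))"
proof (rule integrableI_bounded)
  have "(\<integral>\<^sup>+x. ennreal (norm (exp (- a * l1_norm x))) \<partial>(lborel :: (real ^ 'p) measure)) =
      (\<integral>\<^sup>+x. (\<Prod>b\<in>Basis. ennreal (exp (- a * \<bar>x \<bullet> b\<bar>))) \<partial>(lborel :: (real ^ 'p) measure))"
    by (simp add: l1_norm_def sum_negf[symmetric] sum_distrib_left exp_sum prod_ennreal Basis_real_vec
        prod.reindex inj_axis_one inner_axis abs_prod)
  also have "\<dots> = (\<Prod>b\<in>(Basis :: (real ^ 'p) set). \<integral>\<^sup>+x. ennreal (exp (- a * \<bar>x\<bar>)) \<partial>lborel)"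
    by (rule nn_integral_lborel_prod) auto
  also have "\<dots> < \<infinity>"
    using nn_integral_exp_abs_finite[OF assms] by (simp add: power_eq_top_ennreal flip: less_top)
  finally show "(\<integral>\<^sup>+x. ennreal (norm (exp (- a * l1_norm x))) \<partial>(lborel :: (real ^ 'p) measure)) < \<infinity>" .
qed simp

text \<open>Off the null set of coordinate hyperplanes every sign is determined; the weights are
  shown to converge pointwise there.\<close>

lemma AE_lborel_vec_nonzero: "AE x in lborel. \<forall>i. (x :: real ^ 'p) $ i \<noteq> 0"
proof -
  have "AE x in lborel. (x :: real ^ 'p) $ i \<noteq> 0" for i
    using AE_lborel_inner_neq[of "axis i 1 :: real ^ 'p" 0] by (simp add: inner_axis Basis_real_vec)
  then show ?thesis by (simp add: AE_all_countable)
qed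

lemma matrix_vector_mult_axis_sum:
  fixes A :: "real ^ 'p ^ 'n"
  shows "A *v h = (\<Sum>i\<in>UNIV. h $ i *\<^sub>R (A *v axis i 1))"
  by (simp only: matrix_vector_mult_basis) (simp add: matrix_mult_sum scalar_mult_eq_scaleR)

lemma borel_measurable_lasso_objective [measurable]:
  "lasso_objective A y t \<in> borel_measurable borel"
  unfolding lasso_objective_def[abs_def] divide_inverse
  by (intro borel_measurable_continuous_onI continuous_intros continuous_on_l1_norm linear_continuous_on
      matrix_vector_mul_bounded_linear)

lemma borel_measurable_sgn_at0 [measurable]: "sgn_at0 s0 \<in> borel_measurable borel"
  unfolding sgn_at0_def[abs_def] by measurable

lemma borel_measurable_limit_weight [measurable]:
  "limit_weight s0 A t xhat \<xi> \<in> borel_measurable borel"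
  unfolding limit_weight_def[abs_def] by measurable

lemma limit_weight_nonneg: "limit_weight s0 A t xhat \<xi> x \<ge> 0"
  unfolding limit_weight_def by (intro mult_nonneg_nonneg prod_nonneg) auto

text \<open>The constant function 1 identifies the unknown constant as the reciprocal of the
  integral of \<open>g\<close>, so expectations become ratios of integrals in which constant factors
  cancel.\<close>

lemma expectation_density_proportional:
  fixes g f :: "'b :: euclidean_space \<Rightarrow> real"
  assumes N: "prob_space N" and dens: "has_density_proportional_to N Z g"
    and g [measurable]: "g \<in> borel_measurable borel" and nonneg: "\<And>x. g x \<ge> 0"
    and f [measurable]: "f \<in> borel_measurable borel"
  shows "(\<integral>\<omega>. f (Z \<omega>) \<partial>N) = (\<integral>x. f x * g x \<partial>lborel) / (\<integral>x. g x \<partial>lborel)"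
proof -
  interpret prob_space N by fact
  obtain c where c: "c > 0" and d: "distributed N lborel Z (\<lambda>x. ennreal (c * g x))"
    using dens by (auto simp: has_density_proportional_to_def)
  have eq: "(\<integral>\<omega>. h (Z \<omega>) \<partial>N) = c * (\<integral>x. h x * g x \<partial>lborel)"
    if [measurable]: "h \<in> borel_measurable borel" for h :: "'b \<Rightarrow> real"
    using distributed_integral[OF d, of h] c nonneg by (simp add: mult_ac)
  have "1 = c * (\<integral>x. g x \<partial>lborel)"
    using eq[of "\<lambda>_. 1"] by (simp add: prob_space)
  then have "(\<integral>x. g x \<partial>lborel) = 1 / c"
    using c by (simp add: field_simps)
  with eq[OF f] show ?thesis by (simp add: mult.commute)
qed

section \<open>First-order optimality at the minimiser\<close>

locale lasso_minimizer =
  fixes A :: "real ^ 'p ^ 'n" and y :: "real ^ 'n" and t :: real and xhat \<xi> :: "real ^ 'p"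
  assumes t_pos: "t > 0"
    and minimizer: "is_arg_min (lasso_objective A y t) (\<lambda>_. True) xhat"
    and xi_def: "\<xi> = lasso_xi A y t xhat"
begin

abbreviation (input) J :: "'p set" where "J \<equiv> zero_set xhat - bdry_zero_set xhat \<xi>"
abbreviation (input) K :: "'p set" where "K \<equiv> supp_set xhat \<union> bdry_zero_set xhat \<xi>"

lemma K_eq: "K = - J"
  by (auto simp: supp_set_def bdry_zero_set_def)

lemma notin_J: "i \<in> K \<Longrightarrow> i \<notin> J"
  using K_eq by blast

text \<open>The gap between the absolute value and the affine function of slope
  \<open>\<xi> $ i\<close> that agrees with it at \<open>xhat $ i\<close>. Nonnegativity for all
  \<open>s\<close> says that \<open>\<xi> $ i\<close> is a subgradient there.\<close>

definition slack :: "'p \<Rightarrow> real \<Rightarrow> real" where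
  "slack i s = \<bar>xhat $ i + s\<bar> - \<bar>xhat $ i\<bar> - \<xi> $ i * s"

text \<open>The squared norm expands exactly. By the definition of \<open>\<xi>\<close>, its linear
  term divided by \<open>2 * t\<close> is \<open>- (\<xi> \<bullet> h)\<close>, which is absorbed
  into the slacks.\<close>

lemma objective_increment:
  "lasso_objective A y t (xhat + h) - lasso_objective A y t xhat =
     (\<Sum>i\<in>UNIV. slack i (h $ i)) + (norm (A *v h))\<^sup>2 / (2 * t)"
proof -
  have "(y - A *v xhat) \<bullet> (A *v h) = t * (\<xi> \<bullet> h)"
    using t_pos by (simp add: xi_def lasso_xi_def transpose_matrix_vector dot_lmul_matrix field_simps)
  moreover have "(norm (A *v (xhat + h) - y))\<^sup>2 =
      (norm (A *v xhat - y))\<^sup>2 - 2 * ((y - A *v xhat) \<bullet> (A *v h)) + (norm (A *v h))\<^sup>2"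
    unfolding power2_norm_eq_inner matrix_vector_right_distrib
    by (simp add: inner_simps inner_commute)
  moreover have "(\<Sum>i\<in>UNIV. slack i (h $ i)) = l1_norm (xhat + h) - l1_norm xhat - \<xi> \<bullet> h"
    by (simp add: slack_def l1_norm_def inner_vec_def sum_subtractf)
  ultimately show ?thesis
    using t_pos unfolding lasso_objective_def by (simp add: add_divide_distrib diff_divide_distrib)
qed

lemma axis_scaleR: "axis i r = r *\<^sub>R (axis i 1 :: real ^ 'p)"
  by (simp add: axis_def vec_eq_iff)

text \<open>Along a single axis, minimality gives \<open>slack i r + r\<^sup>2 * q \<ge> 0\<close>.
  The slack is convex and vanishes at 0, so taking \<open>r = l * s\<close>, dividing by
  \<open>l\<close> and letting \<open>l\<close> tend to 0 removes the quadratic term.\<close>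

lemma slack_nonneg: "slack i s \<ge> 0"
proof -
  define q where "q = (norm (A *v axis i 1))\<^sup>2 / (2 * t)"
  have increment: "slack i r + r\<^sup>2 * q \<ge> 0" for r
  proof -
    have "A *v axis i r = r *\<^sub>R (A *v axis i 1)"
      unfolding axis_scaleR[of i r] by (rule matrix_vector_mult_scaleR)
    moreover have "(\<Sum>j\<in>UNIV. slack j (axis i r $ j)) = slack i r"
    proof -
      have "(\<Sum>j\<in>UNIV. slack j (axis i r $ j)) = (\<Sum>j\<in>{i}. slack j (axis i r $ j))"
        by (rule sum.mono_neutral_right) (auto simp: axis_def slack_def)
      then show ?thesis by simp
    qed
    ultimately have "lasso_objective A y t (xhat + axis i r) - lasso_objective A y t xhat =
        slack i r + r\<^sup>2 * q"
      by (simp add: objective_increment q_def power_mult_distrib)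
    then show ?thesis
      using minimizer by (simp add: is_arg_min_def) (smt (verit))
  qed
  have scaled: "slack i (l * s) \<le> l * slack i s" if "0 < l" "l \<le> 1" for l
  proof -
    have "xhat $ i + l * s = (1 - l) * xhat $ i + l * (xhat $ i + s)"
      by (simp add: algebra_simps)
    then have "\<bar>xhat $ i + l * s\<bar> \<le> \<bar>(1 - l) * xhat $ i\<bar> + \<bar>l * (xhat $ i + s)\<bar>"
      by (metis abs_triangle_ineq)
    also have "\<dots> = (1 - l) * \<bar>xhat $ i\<bar> + l * \<bar>xhat $ i + s\<bar>"
      using that by (simp add: abs_mult)
    finally show ?thesis
      by (simp add: slack_def algebra_simps)
  qed
  have lower: "slack i s + l * (s\<^sup>2 * q) \<ge> 0" if "0 < l" "l \<le> 1" for l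
  proof -
    have "0 \<le> l * (slack i s + l * (s\<^sup>2 * q))"
      using increment[of "l * s"] scaled[OF that] by (simp add: power_mult_distrib power2_eq_square algebra_simps)
    then show ?thesis using that by (simp add: zero_le_mult_iff)
  qed
  have "((\<lambda>l. slack i s + l * (s\<^sup>2 * q)) \<longlongrightarrow> slack i s + 0 * (s\<^sup>2 * q)) (at_right 0)"
    by (intro tendsto_intros)
  moreover have "\<forall>\<^sub>F l in at_right 0. slack i s + l * (s\<^sup>2 * q) \<ge> 0"
    unfolding eventually_at_right_field using lower by (intro exI[of _ 1]) auto
  ultimately show ?thesis
    using tendsto_lowerbound by fastforce
qed

lemma abs_xi_le_one: "i \<in> zero_set xhat \<Longrightarrow> \<bar>\<xi> $ i\<bar> \<le> 1"
  using slack_nonneg[of i 1] slack_nonneg[of i "- 1"] by (simp add: slack_def zero_set_def)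

lemma slack_zero_set: "i \<in> zero_set xhat \<Longrightarrow> slack i s = \<bar>s\<bar> - \<xi> $ i * s"
  by (simp add: slack_def zero_set_def)

text \<open>In this range \<open>xhat $ i + s\<close> keeps its sign, so the slack is linear in
  \<open>s\<close>; being nonnegative at both \<open>r\<close> and \<open>- r\<close>, it has slope
  zero.\<close>

lemma slack_supp_set:
  assumes "i \<in> supp_set xhat" "\<bar>s\<bar> < \<bar>xhat $ i\<bar>"
  shows "slack i s = 0"
proof -
  have lin: "slack i r = (sgn (xhat $ i) - \<xi> $ i) * r" if "\<bar>r\<bar> < \<bar>xhat $ i\<bar>" for r
    using that by (auto simp: slack_def sgn_if algebra_simps)
  define r where "r = \<bar>xhat $ i\<bar> / 2"
  have r: "r > 0" "\<bar>r\<bar> < \<bar>xhat $ i\<bar>" "\<bar>- r\<bar> < \<bar>xhat $ i\<bar>"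
    using assms by (auto simp: r_def supp_set_def zero_set_def)
  have "(sgn (xhat $ i) - \<xi> $ i) * r \<ge> 0" "(sgn (xhat $ i) - \<xi> $ i) * r \<le> 0"
    using slack_nonneg[of i r] slack_nonneg[of i "- r"] lin[OF r(2)] lin[OF r(3)] by auto
  with r have "sgn (xhat $ i) - \<xi> $ i = 0"
    by (metis mult_eq_0_iff order_antisym less_irrefl)
  with lin[OF assms(2)] show ?thesis by simp
qed

section \<open>Rescaled coordinates and the energy\<close>

text \<open>Inverts \<open>rescaled\<close> once \<open>xhat\<close> is added; on \<open>J\<close>
  that shift is zero.\<close>

definition step :: "real \<Rightarrow> real ^ 'p \<Rightarrow> real ^ 'p" where
  "step T z = (\<chi> i. (if i \<in> J then T else sqrt T) * z $ i)"

text \<open>Subtracting the minimum changes the density by a constant factor only, and keeps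
  \<open>exp (- energy T z)\<close> bounded as \<open>T\<close> decreases to 0.\<close>

definition energy :: "real \<Rightarrow> real ^ 'p \<Rightarrow> real" where
  "energy T z = (lasso_objective A y t (xhat + step T z) - lasso_objective A y t xhat) / T"

definition lin_part :: "'p set \<Rightarrow> real ^ 'p \<Rightarrow> real ^ 'n" where
  "lin_part I z = (\<Sum>i\<in>I. z $ i *\<^sub>R (A *v axis i 1))"

lemma rescaled_step: "T > 0 \<Longrightarrow> rescaled xhat \<xi> T (xhat + step T z) = z"
  by (auto simp: rescaled_def step_def vec_eq_iff zero_set_def)

lemma sum_split_JK: "(\<Sum>i\<in>UNIV. f i) = (\<Sum>i\<in>J. f i) + (\<Sum>i\<in>K. f i)" for f :: "'p \<Rightarrow> 'z :: comm_monoid_add"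
proof -
  have "UNIV = J \<union> K" "J \<inter> K = {}" using K_eq by auto
  then show ?thesis by (metis sum.union_disjoint finite_code)
qed

text \<open>On \<open>J\<close> the slack is positively homogeneous, so \<open>T\<close> cancels. In
  the quadratic term a factor \<open>sqrt T\<close> comes out of the norm, and its square cancels
  the division by \<open>T\<close>.\<close>

lemma energy_eq:
  assumes "T > 0"
  shows "energy T z = (\<Sum>i\<in>J. \<bar>z $ i\<bar> - \<xi> $ i * z $ i) + (\<Sum>i\<in>K. slack i (sqrt T * z $ i) / T)
     + (norm (sqrt T *\<^sub>R lin_part J z + lin_part K z))\<^sup>2 / (2 * t)"
proof -
  have step_K: "step T z $ i = sqrt T * z $ i" if "i \<in> K" for i
    using notin_J[OF that] by (auto simp: step_def)
  have "A *v step T z = lin_part J (step T z) + lin_part K (step T z)"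
    unfolding lin_part_def by (subst matrix_vector_mult_axis_sum) (rule sum_split_JK)
  also have "lin_part J (step T z) = T *\<^sub>R lin_part J z"
    unfolding lin_part_def by (simp add: step_def scaleR_sum_right)
  also have "lin_part K (step T z) = sqrt T *\<^sub>R lin_part K z"
    unfolding lin_part_def scaleR_sum_right by (rule sum.cong) (simp_all only: step_K scaleR_scaleR)
  also have "T *\<^sub>R lin_part J z + sqrt T *\<^sub>R lin_part K z =
      sqrt T *\<^sub>R (sqrt T *\<^sub>R lin_part J z + lin_part K z)"
    using assms by (simp add: scaleR_add_right)
  finally have "(norm (A *v step T z))\<^sup>2 = T * (norm (sqrt T *\<^sub>R lin_part J z + lin_part K z))\<^sup>2"
    using assms by (simp add: power_mult_distrib)
  moreover have "(\<Sum>i\<in>J. slack i (step T z $ i)) = T * (\<Sum>i\<in>J. \<bar>z $ i\<bar> - \<xi> $ i * z $ i)"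
    unfolding sum_distrib_left using assms
    by (intro sum.cong) (auto simp: step_def slack_zero_set abs_mult algebra_simps)
  moreover have "(\<Sum>i\<in>K. slack i (step T z $ i)) = T * (\<Sum>i\<in>K. slack i (sqrt T * z $ i) / T)"
    unfolding sum_distrib_left using assms
    by (intro sum.cong) (simp_all add: step_K)
  ultimately show ?thesis
    using assms by (simp add: energy_def objective_increment sum_split_JK add_divide_distrib)
qed

section \<open>Integrable lower bound, uniform in the temperature\<close>

text \<open>A left inverse of the Gram matrix recovers each \<open>z $ i\<close> from the inner
  products of \<open>lin_part K z\<close> with the columns of \<open>A\<close> in \<open>K\<close>;
  Cauchy-Schwarz then bounds it.\<close>

lemma lin_part_coercive:
  assumes "invertible_on K (\<lambda>i j. (A *v axis i 1) \<bullet> (A *v axis j 1))"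
  obtains C where "C > 0" "\<And>z. (\<Sum>i\<in>K. \<bar>z $ i\<bar>) \<le> C * norm (lin_part K z)"
proof -
  obtain B where B: "\<forall>i\<in>K. \<forall>j\<in>K.
      (\<Sum>k\<in>K. B i k * ((A *v axis k 1) \<bullet> (A *v axis j 1))) = (if i = j then 1 else 0)"
    using assms unfolding invertible_on_def by blast
  define C where "C = (\<Sum>i\<in>K. \<Sum>k\<in>K. \<bar>B i k\<bar> * norm (A *v axis k 1))"
  have "C \<ge> 0" unfolding C_def by (intro sum_nonneg) auto
  have "(\<Sum>i\<in>K. \<bar>z $ i\<bar>) \<le> C * norm (lin_part K z)" for z
    unfolding C_def sum_distrib_right
  proof (rule sum_mono)
    fix i assume i: "i \<in> K"
    have "(\<Sum>k\<in>K. B i k * ((A *v axis k 1) \<bullet> lin_part K z)) =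
        (\<Sum>k\<in>K. \<Sum>j\<in>K. z $ j * (B i k * ((A *v axis k 1) \<bullet> (A *v axis j 1))))"
      by (simp add: lin_part_def inner_sum_right sum_distrib_left mult_ac)
    also have "\<dots> = (\<Sum>j\<in>K. z $ j * (\<Sum>k\<in>K. B i k * ((A *v axis k 1) \<bullet> (A *v axis j 1))))"
      by (subst sum.swap) (simp add: sum_distrib_left)
    also have "\<dots> = (\<Sum>j\<in>K. if i = j then z $ j else 0)"
      using B i by (intro sum.cong) auto
    also have "\<dots> = z $ i" using i by simp
    finally have "\<bar>z $ i\<bar> = \<bar>\<Sum>k\<in>K. B i k * ((A *v axis k 1) \<bullet> lin_part K z)\<bar>" by simp
    also have "\<dots> \<le> (\<Sum>k\<in>K. \<bar>B i k * ((A *v axis k 1) \<bullet> lin_part K z)\<bar>)" by (rule sum_abs)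
    also have "\<dots> \<le> (\<Sum>k\<in>K. \<bar>B i k\<bar> * norm (A *v axis k 1) * norm (lin_part K z))"
      by (intro sum_mono) (simp add: abs_mult mult.assoc Cauchy_Schwarz_ineq2 mult_left_mono)
    finally show "\<bar>z $ i\<bar> \<le> (\<Sum>k\<in>K. \<bar>B i k\<bar> * norm (A *v axis k 1) * norm (lin_part K z))" .
  qed
  \<comment> \<open>\<open>C\<close> is 0 when \<open>K\<close> is empty; adding 1 makes the
    constant positive, so that it may be divided by.\<close>
  then have "(\<Sum>i\<in>K. \<bar>z $ i\<bar>) \<le> (C + 1) * norm (lin_part K z)" for z
    by (rule order_trans) (simp add: distrib_right)
  with \<open>C \<ge> 0\<close> that[of "C + 1"] show ?thesis by simp
qed

text \<open>The quadratic term of the energy mixes the two blocks, and its expansion contains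
  \<open>T * norm (lin_part J z)\<^sup>2\<close>, which the linear decay in the first block does not dominate uniformly
  in \<open>z\<close>. Bounding \<open>q\<^sup>2 / (2 * t)\<close>, with \<open>q\<close> the norm, below by
  a small multiple of \<open>q\<close> minus a constant avoids this.\<close>

lemma energy_lower_bound:
  assumes "invertible_on K (\<lambda>i j. (A *v axis i 1) \<bullet> (A *v axis j 1))"
  obtains a b where "a > 0" "\<And>T z. 0 < T \<Longrightarrow> T \<le> 1 \<Longrightarrow> energy T z \<ge> a * l1_norm z - b"
proof -
  obtain C where C: "C > 0" "\<And>z. (\<Sum>i\<in>K. \<bar>z $ i\<bar>) \<le> C * norm (lin_part K z)"
    using lin_part_coercive[OF assms] by blast
  \<comment> \<open>The distance of \<open>\<bar>\<xi> $ i\<bar>\<close> from 1 over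
    \<open>J\<close> is the rate of linear decay there. The inserted 1 covers empty
    \<open>J\<close>.\<close>
  define \<delta> where "\<delta> = Min (insert 1 ((\<lambda>i. 1 - \<bar>\<xi> $ i\<bar>) ` J))"
  have \<delta>_pos: "\<delta> > 0"
  proof -
    have "\<bar>\<xi> $ i\<bar> < 1" if "i \<in> J" for i
      using that abs_xi_le_one[of i] by (auto simp: bdry_zero_set_def order.order_iff_strict)
    then show ?thesis unfolding \<delta>_def by (subst Min_gr_iff) auto
  qed
  have \<delta>_le: "\<delta> \<le> 1 - \<bar>\<xi> $ i\<bar>" if "i \<in> J" for i
    unfolding \<delta>_def using that by (intro Min_le) auto
  define D where "D = (\<Sum>i\<in>UNIV. norm (A *v axis i 1)) + 1"
  have D_pos: "D > 0"
    unfolding D_def by (intro add_nonneg_pos sum_nonneg) auto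
  have D: "norm (lin_part J z) \<le> D * (\<Sum>i\<in>J. \<bar>z $ i\<bar>)" for z
    unfolding lin_part_def sum_distrib_left
  proof (rule sum_norm_le)
    fix i
    have "norm (A *v axis i 1) \<le> D"
      unfolding D_def using member_le_sum[of i UNIV "\<lambda>i. norm (A *v axis i 1)"] by simp
    then show "norm (z $ i *\<^sub>R (A *v axis i 1)) \<le> D * \<bar>z $ i\<bar>"
      by (simp add: mult.commute[of D] mult_left_mono)
  qed
  \<comment> \<open>Chosen so that the cross term between the blocks costs only half of the decay
    \<open>\<delta>\<close> available on \<open>J\<close>.\<close>
  define \<epsilon> where "\<epsilon> = \<delta> / (2 * D)"
  have \<epsilon>: "\<epsilon> > 0" "\<epsilon> * D = \<delta> / 2"
    using \<delta>_pos D_pos by (auto simp: \<epsilon>_def)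
  define a where "a = min (\<delta> / 2) (\<epsilon> / C)"
  have "energy T z \<ge> a * l1_norm z - \<epsilon>\<^sup>2 * t / 2" if T: "0 < T" "T \<le> 1" for T z
  proof -
    define s r where "s = (\<Sum>i\<in>J. \<bar>z $ i\<bar>)" and "r = (\<Sum>i\<in>K. \<bar>z $ i\<bar>)"
    define q where "q = norm (sqrt T *\<^sub>R lin_part J z + lin_part K z)"
    have nonneg: "s \<ge> 0" "r \<ge> 0" by (auto simp: s_def r_def intro: sum_nonneg)
    have "norm (lin_part K z) \<le> q + norm (sqrt T *\<^sub>R lin_part J z)"
      unfolding q_def by (metis add.commute add_diff_cancel_right' norm_triangle_ineq4)
    \<comment> \<open>This is where \<open>T \<le> 1\<close> enters.\<close>
    moreover have "norm (sqrt T *\<^sub>R lin_part J z) \<le> 1 * norm (lin_part J z)"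
      unfolding norm_scaleR using T by (intro mult_right_mono) auto
    moreover have "r / C \<le> norm (lin_part K z)"
      using C by (simp add: r_def field_simps)
    ultimately have "r / C - D * s \<le> q"
      using D[of z] by (simp add: s_def)
    then have "\<epsilon> * (r / C - D * s) \<le> \<epsilon> * q"
      using \<epsilon> by (intro mult_left_mono) auto
    \<comment> \<open>Expanding \<open>(q - \<epsilon> * t)\<^sup>2 \<ge> 0\<close> replaces the
      square by a linear bound.\<close>
    also have "\<dots> \<le> q\<^sup>2 / (2 * t) + \<epsilon>\<^sup>2 * t / 2"
      using t_pos zero_le_power2[of "q - \<epsilon> * t"]
      by (simp add: power2_eq_square field_simps)
    also have "\<epsilon> * (r / C - D * s) = \<epsilon> / C * r - \<delta> / 2 * s"
      unfolding \<epsilon>(2)[symmetric] by (simp add: right_diff_distrib)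
    finally have q: "\<epsilon> / C * r - \<delta> / 2 * s - \<epsilon>\<^sup>2 * t / 2 \<le> q\<^sup>2 / (2 * t)"
      by simp
    have "\<delta> * s \<le> (\<Sum>i\<in>J. \<bar>z $ i\<bar> - \<xi> $ i * z $ i)"
      unfolding s_def sum_distrib_left
    proof (rule sum_mono)
      fix i assume "i \<in> J"
      then have "\<delta> * \<bar>z $ i\<bar> \<le> (1 - \<bar>\<xi> $ i\<bar>) * \<bar>z $ i\<bar>"
        by (intro mult_right_mono \<delta>_le) auto
      also have "\<dots> \<le> \<bar>z $ i\<bar> - \<xi> $ i * z $ i"
        using abs_ge_self[of "\<xi> $ i * z $ i"] by (simp add: abs_mult algebra_simps)
      finally show "\<delta> * \<bar>z $ i\<bar> \<le> \<bar>z $ i\<bar> - \<xi> $ i * z $ i" .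
    qed
    moreover have "(\<Sum>i\<in>K. slack i (sqrt T * z $ i) / T) \<ge> 0"
      using T by (intro sum_nonneg divide_nonneg_pos slack_nonneg)
    ultimately have "energy T z \<ge> \<delta> / 2 * s + \<epsilon> / C * r - \<epsilon>\<^sup>2 * t / 2"
      using q energy_eq[OF T(1), of z] by (simp add: q_def)
    moreover have "a * s \<le> \<delta> / 2 * s"
      using nonneg(1) unfolding a_def by (intro mult_right_mono min.cobounded1)
    moreover have "a * r \<le> \<epsilon> / C * r"
      using nonneg(2) unfolding a_def by (intro mult_right_mono min.cobounded2)
    moreover have "a * l1_norm z = a * s + a * r"
      unfolding l1_norm_def s_def r_def sum_split_JK by (rule distrib_left)
    ultimately show ?thesis by linarith
  qed
  moreover have "a > 0" using \<delta>_pos \<epsilon> C by (simp add: a_def)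
  ultimately show ?thesis using that by blast
qed

section \<open>Pointwise limit of the rescaled weight\<close>

text \<open>By homogeneity the exponent is
  \<open>- (\<bar>x\<bar> - \<xi> $ i * x) / sqrt T\<close>. The numerator is 0 if \<open>x\<close>
  has the sign of \<open>\<xi> $ i\<close> and \<open>2 * \<bar>x\<bar>\<close> otherwise, so the
  limit is an indicator.\<close>

lemma bdry_factor_tendsto:
  assumes "i \<in> bdry_zero_set xhat \<xi>" "x \<noteq> 0"
  shows "((\<lambda>T. exp (- (slack i (sqrt T * x) / T))) \<longlongrightarrow> of_bool (sgn_at0 s0 x * \<xi> $ i = 1)) (at_right 0)"
proof -
  have i: "i \<in> zero_set xhat" "\<bar>\<xi> $ i\<bar> = 1" using assms by (auto simp: bdry_zero_set_def)
  have ev: "\<forall>\<^sub>F T in at_right 0. slack i (sqrt T * x) / T = (\<bar>x\<bar> - \<xi> $ i * x) * inverse (sqrt T)"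
    unfolding eventually_at_right_field
  proof (intro exI[of _ 1] conjI allI impI)
    fix T :: real assume "0 < T"
    then have "T = sqrt T * sqrt T" "sqrt T > 0" by auto
    then show "slack i (sqrt T * x) / T = (\<bar>x\<bar> - \<xi> $ i * x) * inverse (sqrt T)"
      using i \<open>0 < T\<close> by (simp add: slack_zero_set abs_mult) (simp add: field_simps)
  qed simp
  have xi: "\<xi> $ i = 1 \<or> \<xi> $ i = - 1" using i by (auto simp: abs_if split: if_splits)
  show ?thesis
  proof (cases "sgn_at0 s0 x * \<xi> $ i = 1")
    case True
    then have "\<bar>x\<bar> - \<xi> $ i * x = 0"
      using xi assms(2) by (auto simp: sgn_at0_def split: if_splits)
    with ev have "\<forall>\<^sub>F T in at_right 0. exp (- (slack i (sqrt T * x) / T)) = of_bool (sgn_at0 s0 x * \<xi> $ i = 1)"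
      using True by (auto elim!: eventually_mono)
    then show ?thesis by (rule tendsto_eventually)
  next
    case False
    then have pos: "\<bar>x\<bar> - \<xi> $ i * x > 0"
      using xi assms(2) by (auto simp: sgn_at0_def split: if_splits)
    have "((\<lambda>T. exp (- ((\<bar>x\<bar> - \<xi> $ i * x) * inverse (sqrt T)))) \<longlongrightarrow> 0) (at_right 0)"
    proof (rule filterlim_compose[OF exp_at_bot])
      have "filterlim (\<lambda>T. inverse (sqrt T)) at_top (at_right 0)"
      proof (rule filterlim_inverse_at_top)
        have "((\<lambda>T. sqrt T) \<longlongrightarrow> sqrt 0) (at_right 0)"
          by (intro tendsto_intros)
        then show "((\<lambda>T. sqrt T) \<longlongrightarrow> 0) (at_right 0)" by simp
      qed (auto simp: eventually_at_right_field intro: exI[of _ 1])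
      then show "filterlim (\<lambda>T. - ((\<bar>x\<bar> - \<xi> $ i * x) * inverse (sqrt T))) at_bot (at_right 0)"
        unfolding filterlim_uminus_at_bot[symmetric]
        by (subst filterlim_uminus_at_bot)
          (use filterlim_tendsto_pos_mult_at_top[OF tendsto_const pos] in simp)
    qed
    moreover have "\<forall>\<^sub>F T in at_right 0. exp (- ((\<bar>x\<bar> - \<xi> $ i * x) * inverse (sqrt T))) =
        exp (- (slack i (sqrt T * x) / T))"
      using ev by eventually_elim simp
    ultimately show ?thesis
      using False by (simp add: tendsto_cong)
  qed
qed

text \<open>For small \<open>T\<close> the displacement \<open>sqrt T * x\<close> is shorter than
  \<open>\<bar>xhat $ i\<bar>\<close>, so the factor is eventually equal to 1.\<close>

lemma supp_factor_tendsto: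
  assumes "i \<in> supp_set xhat"
  shows "((\<lambda>T. exp (- (slack i (sqrt T * x) / T))) \<longlongrightarrow> 1) (at_right 0)"
proof -
  have "((\<lambda>T. \<bar>sqrt T * x\<bar>) \<longlongrightarrow> \<bar>sqrt 0 * x\<bar>) (at_right 0)"
    by (intro tendsto_intros)
  moreover have "\<bar>sqrt 0 * x\<bar> < \<bar>xhat $ i\<bar>"
    using assms by (simp add: supp_set_def zero_set_def)
  ultimately have "\<forall>\<^sub>F T in at_right 0. \<bar>sqrt T * x\<bar> < \<bar>xhat $ i\<bar>"
    by (rule order_tendstoD(2))
  then have "\<forall>\<^sub>F T in at_right 0. exp (- (slack i (sqrt T * x) / T)) = 1"
    by eventually_elim (simp add: slack_supp_set[OF assms])
  then show ?thesis by (rule tendsto_eventually)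
qed

lemma exp_energy_tendsto:
  assumes "\<forall>i. z $ i \<noteq> 0"
  shows "((\<lambda>T. exp (- energy T z)) \<longlongrightarrow> limit_weight s0 A t xhat \<xi> z) (at_right 0)"
proof -
  \<comment> \<open>The limit is taken factor by factor, since the energy itself may diverge through
    the boundary terms.\<close>
  define E where "E T = (\<Prod>i\<in>J. exp (- (\<bar>z $ i\<bar> - \<xi> $ i * z $ i)))
      * exp (- ((norm (sqrt T *\<^sub>R lin_part J z + lin_part K z))\<^sup>2 / (2 * t)))
      * (\<Prod>i\<in>K. exp (- (slack i (sqrt T * z $ i) / T)))" for T
  define L where "L i = (if i \<in> bdry_zero_set xhat \<xi> then of_bool (sgn_at0 s0 (z $ i) * \<xi> $ i = 1) else 1 :: real)" for i
  have ev: "\<forall>\<^sub>F T in at_right 0. E T = exp (- energy T z)"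
    unfolding eventually_at_right_field
    by (intro exI[of _ 1]) (simp add: energy_eq E_def flip: exp_sum exp_add add: sum_negf sum_subtractf)
  have lim: "(E \<longlongrightarrow> (\<Prod>i\<in>J. exp (- (\<bar>z $ i\<bar> - \<xi> $ i * z $ i)))
      * exp (- ((norm (sqrt 0 *\<^sub>R lin_part J z + lin_part K z))\<^sup>2 / (2 * t)))
      * (\<Prod>i\<in>K. L i)) (at_right 0)"
    unfolding E_def
  proof (intro tendsto_intros)
    fix i assume "i \<in> K"
    then show "((\<lambda>T. exp (- (slack i (sqrt T * z $ i) / T))) \<longlongrightarrow> L i) (at_right 0)"
      using bdry_factor_tendsto[of i "z $ i"] supp_factor_tendsto[of i "z $ i"] assms
      by (auto simp: L_def)
  qed (use t_pos in auto)
  have weight: "(\<Prod>i\<in>J. exp (- (\<bar>z $ i\<bar> - \<xi> $ i * z $ i)))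
      * exp (- ((norm (sqrt 0 *\<^sub>R lin_part J z + lin_part K z))\<^sup>2 / (2 * t)))
      * (\<Prod>i\<in>K. L i) = limit_weight s0 A t xhat \<xi> z"
  proof -
    have "(\<Prod>i\<in>K. L i) = (\<Prod>i\<in>bdry_zero_set xhat \<xi>. L i)"
      by (rule prod.mono_neutral_right) (auto simp: L_def)
    also have "\<dots> = (\<Prod>i\<in>bdry_zero_set xhat \<xi>. of_bool (sgn_at0 s0 (z $ i) * \<xi> $ i = 1))"
      by (rule prod.cong) (auto simp: L_def)
    finally have 1: "(\<Prod>i\<in>K. L i) = (\<Prod>i\<in>bdry_zero_set xhat \<xi>. of_bool (sgn_at0 s0 (z $ i) * \<xi> $ i = 1))" .
    \<comment> \<open>Uses \<open>\<bar>x\<bar> * sgn_at0 s0 x = x\<close> for nonzero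
      \<open>x\<close>.\<close>
    have "(\<Prod>i\<in>J. exp (- (\<bar>z $ i\<bar> - \<xi> $ i * z $ i))) =
        (\<Prod>i\<in>J. exp (- \<bar>z $ i\<bar> * (1 - sgn_at0 s0 (z $ i) * \<xi> $ i)))"
      using assms by (intro prod.cong) (auto simp: sgn_at0_def algebra_simps abs_if)
    then show ?thesis by (simp add: 1 limit_weight_def lin_part_def)
  qed
  show ?thesis
    using Lim_transform_eventually[OF lim ev] unfolding weight .
qed

section \<open>Convergence of the integrals\<close>

lemma borel_measurable_energy [measurable]: "energy T \<in> borel_measurable borel"
proof -
  have [measurable]: "step T \<in> borel_measurable borel"
    unfolding step_def[abs_def]
    by (intro borel_measurable_continuous_onI continuous_intros)
  show ?thesis unfolding energy_def[abs_def] by measurable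
qed

lemma
  fixes f :: "real ^ 'p \<Rightarrow> real"
  assumes inv: "invertible_on K (\<lambda>i j. (A *v axis i 1) \<bullet> (A *v axis j 1))"
    and f [measurable]: "f \<in> borel_measurable borel" and bdd: "bounded (range f)"
  shows integrable_limit_weight: "integrable lborel (\<lambda>z. f z * limit_weight s0 A t xhat \<xi> z)"
    and integral_exp_energy_tendsto:
      "((\<lambda>T. \<integral>z. f z * exp (- energy T z) \<partial>lborel) \<longlongrightarrow>
        (\<integral>z. f z * limit_weight s0 A t xhat \<xi> z \<partial>lborel)) (at_right 0)"
proof -
  obtain a b where a: "a > 0"
    and b: "\<And>T z. 0 < T \<Longrightarrow> T \<le> 1 \<Longrightarrow> energy T z \<ge> a * l1_norm z - b"
    using energy_lower_bound[OF inv] by blast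
  obtain B where B: "\<And>z. norm (f z) \<le> B"
    using bdd by (auto simp: bounded_iff)
  have "B \<ge> 0" using B[of 0] norm_ge_zero order_trans by blast
  \<comment> \<open>The lower bound on the energy makes this dominate for all \<open>T\<close> in
    \<open>{0<..1}\<close>.\<close>
  define w where "w z = B * exp b * exp (- a * l1_norm z)" for z :: "real ^ 'p"
  have w: "integrable lborel w"
    unfolding w_def[abs_def] using integrable_exp_l1_norm[OF a] by (intro integrable_mult_right) auto
  have bound: "norm (f z * exp (- energy T z)) \<le> w z" if "0 < T" "T \<le> 1" for T z
  proof -
    have "exp (- energy T z) \<le> exp (b + - a * l1_norm z)"
      using b[OF that, of z] by simp
    then show ?thesis
      unfolding w_def norm_mult mult.assoc exp_add[symmetric] using B[of z] \<open>B \<ge> 0\<close>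
      by (intro mult_mono) auto
  qed
  \<comment> \<open>Replacing \<open>T\<close> by \<open>inverse T\<close> turns
    \<open>at_right 0\<close> into \<open>at_top\<close>, the filter of the dominated convergence
    rules used below.\<close>
  have ev: "\<forall>\<^sub>F T in at_top. AE z in lborel. norm (f z * exp (- energy (inverse T) z)) \<le> w z"
    using eventually_ge_at_top[of 1]
    by eventually_elim (intro AE_I2 bound, auto simp: inverse_le_1_iff)
  have lim: "AE z in lborel. ((\<lambda>T. f z * exp (- energy (inverse T) z)) \<longlongrightarrow>
      f z * limit_weight s0 A t xhat \<xi> z) at_top"
    using AE_lborel_vec_nonzero
  proof eventually_elim
    case (elim z)
    then show ?case
      using exp_energy_tendsto[of z s0] unfolding filterlim_at_right_to_top by (intro tendsto_intros)
  qed
  show "integrable lborel (\<lambda>z. f z * limit_weight s0 A t xhat \<xi> z)"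
    by (rule integrable_dominated_convergence_at_top[OF _ _ w lim ev]) auto
  show "((\<lambda>T. \<integral>z. f z * exp (- energy T z) \<partial>lborel) \<longlongrightarrow>
        (\<integral>z. f z * limit_weight s0 A t xhat \<xi> z \<partial>lborel)) (at_right 0)"
    unfolding filterlim_at_right_to_top
    by (rule integral_dominated_convergence_at_top[OF _ _ w lim ev]) auto
qed

section \<open>Change of variables and positivity of the limit mass\<close>

lemma exp_objective_step:
  assumes "T > 0"
  shows "exp (- (1 / T) * lasso_objective A y t (xhat + step T z)) =
    exp (- (1 / T) * lasso_objective A y t xhat) * exp (- energy T z)"
  using assms by (simp add: energy_def diff_divide_distrib flip: exp_add)

text \<open>The substitution by \<open>step\<close> produces the same factor \<open>p\<close>,
  Jacobian times weight at \<open>xhat\<close>, in numerator and denominator. The denominator is the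
  case of the constant function 1.\<close>

lemma expectation_rescaled:
  fixes f :: "real ^ 'p \<Rightarrow> real"
  assumes T: "T > 0" and P: "prob_space P"
    and dens: "has_density_proportional_to P Y (\<lambda>x. exp (- (1 / T) * lasso_objective A y t x))"
    and f [measurable]: "f \<in> borel_measurable borel"
  shows "(\<integral>\<omega>. f (rescaled xhat \<xi> T (Y \<omega>)) \<partial>P) =
    (\<integral>z. f z * exp (- energy T z) \<partial>lborel) / (\<integral>z. exp (- energy T z) \<partial>lborel)"
proof -
  let ?g = "\<lambda>x. exp (- (1 / T) * lasso_objective A y t x)"
  define c where "c i = (if i \<in> J then T else sqrt T)" for i
  have c: "c i \<noteq> 0" for i using T by (simp add: c_def)
  define p where "p = (\<Prod>i\<in>UNIV. \<bar>c i\<bar>) * ?g xhat"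
  have "p \<noteq> 0" using c by (simp add: p_def)
  have [measurable]: "rescaled xhat \<xi> T \<in> borel_measurable borel"
    unfolding rescaled_def[abs_def] divide_inverse
  proof (intro borel_measurable_continuous_onI continuous_on_vec_lambda)
    show "continuous_on UNIV (\<lambda>x. if i \<in> J then x $ i * inverse T
        else (x $ i - xhat $ i) * inverse (sqrt T))" for i
      by (cases "i \<in> J") (auto intro!: continuous_intros)
  qed
  have subst: "(\<integral>x. h (rescaled xhat \<xi> T x) * ?g x \<partial>lborel) = p * (\<integral>z. h z * exp (- energy T z) \<partial>lborel)"
    if [measurable]: "h \<in> borel_measurable borel" for h :: "real ^ 'p \<Rightarrow> real"
  proof -
    have "(\<integral>x. h (rescaled xhat \<xi> T x) * ?g x \<partial>lborel) =
        (\<Prod>i\<in>UNIV. \<bar>c i\<bar>) * (\<integral>z. h (rescaled xhat \<xi> T (xhat + step T z)) * ?g (xhat + step T z) \<partial>lborel)"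
      unfolding step_def c_def[symmetric] by (rule integral_lborel_affine_vec[OF c]) measurable
    also have "\<dots> = (\<Prod>i\<in>UNIV. \<bar>c i\<bar>) * (\<integral>z. ?g xhat * (h z * exp (- energy T z)) \<partial>lborel)"
      by (simp only: rescaled_step[OF T] exp_objective_step[OF T] mult_ac)
    finally show ?thesis by (simp only: integral_mult_right_zero p_def mult.assoc)
  qed
  have "(\<integral>\<omega>. f (rescaled xhat \<xi> T (Y \<omega>)) \<partial>P) =
      (\<integral>x. f (rescaled xhat \<xi> T x) * ?g x \<partial>lborel) / (\<integral>x. ?g x \<partial>lborel)"
    by (rule expectation_density_proportional[OF P dens]) auto
  then show ?thesis
    using subst[OF f] subst[of "\<lambda>_. 1"] \<open>p \<noteq> 0\<close> by simp
qed

text \<open>A nonnegative weight with integral zero vanishes almost everywhere, but this one is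
  nonzero on a nonempty open set, which is not negligible.\<close>

lemma integral_limit_weight_pos:
  assumes inv: "invertible_on K (\<lambda>i j. (A *v axis i 1) \<bullet> (A *v axis j 1))"
  shows "(\<integral>z. limit_weight s0 A t xhat \<xi> z \<partial>lborel) > 0"
proof (rule ccontr)
  let ?w = "limit_weight s0 A t xhat \<xi>"
  assume "\<not> (\<integral>z. ?w z \<partial>lborel) > 0"
  then have "(\<integral>z. ?w z \<partial>lborel) = 0"
    using Bochner_Integration.integral_nonneg[of lborel ?w, OF limit_weight_nonneg] by simp
  moreover have "integrable lborel ?w"
    using integrable_limit_weight[OF inv, of "\<lambda>_. 1" s0] by simp
  ultimately have AE: "AE z in lborel. ?w z = 0"
    by (simp add: integral_nonneg_eq_0_iff_AE limit_weight_nonneg)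
  define U where "U = (\<Inter>i\<in>bdry_zero_set xhat \<xi>. {z. z $ i * \<xi> $ i > 0})"
  have "?w z \<noteq> 0" if "z \<in> U" for z
  proof -
    have "sgn_at0 s0 (z $ i) * \<xi> $ i = 1" if "i \<in> bdry_zero_set xhat \<xi>" for i
    proof -
      have "z $ i * \<xi> $ i > 0" using \<open>z \<in> U\<close> that by (auto simp: U_def)
      moreover have "\<xi> $ i = 1 \<or> \<xi> $ i = - 1"
        using that by (auto simp: bdry_zero_set_def abs_if split: if_splits)
      ultimately show ?thesis by (auto simp: sgn_at0_def)
    qed
    then show ?thesis by (simp add: limit_weight_def)
  qed
  with AE have AE_U: "AE z in lborel. z \<notin> U" by (auto elim: eventually_mono)
  have "open U"
    unfolding U_def by (intro open_INT ballI open_Collect_less continuous_intros) auto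
  have "U \<in> null_sets lborel"
    using AE_U \<open>open U\<close> by (subst AE_iff_null_sets) auto
  then have "negligible U"
    by (simp add: negligible_iff_null_sets null_sets_completionI)
  \<comment> \<open>\<open>\<xi>\<close> itself witnesses nonemptiness: on the boundary indices its
    coordinates square to 1.\<close>
  moreover have "\<xi> \<in> U"
    by (auto simp: U_def bdry_zero_set_def zero_less_mult_iff abs_if split: if_splits)
  ultimately show False
    using open_not_negligible[OF \<open>open U\<close>] by blast
qed

text \<open>Both expectations are ratios of integrals; numerators and denominators converge, and the
  limit of the denominators is positive.\<close>

lemma converges_rescaled:
  assumes inv: "invertible_on K (\<lambda>i j. (A *v axis i 1) \<bullet> (A *v axis j 1))"
    and M: "\<And>T. T > 0 \<Longrightarrow> prob_space (M T)"
    and X: "\<And>T. T > 0 \<Longrightarrow>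
      has_density_proportional_to (M T) (X T) (\<lambda>x. exp (- (1 / T) * lasso_objective A y t x))"
    and N: "prob_space N" "has_density_proportional_to N Z (limit_weight s0 A t xhat \<xi>)"
  shows "converges_in_distribution M (\<lambda>T \<omega>. rescaled xhat \<xi> T (X T \<omega>)) N Z (at_right 0)"
  unfolding converges_in_distribution_def
proof (intro allI impI)
  fix f :: "real ^ 'p \<Rightarrow> real"
  assume "continuous_on UNIV f" and bdd: "bounded (range f)"
  then have f [measurable]: "f \<in> borel_measurable borel"
    by (intro borel_measurable_continuous_onI)
  have lim: "((\<lambda>T. (\<integral>z. f z * exp (- energy T z) \<partial>lborel) / (\<integral>z. exp (- energy T z) \<partial>lborel)) \<longlongrightarrow>
      (\<integral>z. f z * limit_weight s0 A t xhat \<xi> z \<partial>lborel) / (\<integral>z. limit_weight s0 A t xhat \<xi> z \<partial>lborel)) (at_right 0)"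
    using integral_limit_weight_pos[OF inv, of s0] integral_exp_energy_tendsto[OF inv, of "\<lambda>_. 1" s0]
    by (intro tendsto_divide integral_exp_energy_tendsto[OF inv f bdd]) auto
  have eq: "\<forall>\<^sub>F T in at_right 0.
      (\<integral>z. f z * exp (- energy T z) \<partial>lborel) / (\<integral>z. exp (- energy T z) \<partial>lborel) =
      (\<integral>\<omega>. f (rescaled xhat \<xi> T (X T \<omega>)) \<partial>M T)"
    unfolding eventually_at_right_field
    by (intro exI[of _ 1]) (simp add: expectation_rescaled[OF _ M X f])
  show "((\<lambda>T. \<integral>\<omega>. f (rescaled xhat \<xi> T (X T \<omega>)) \<partial>M T) \<longlongrightarrow> (\<integral>\<omega>. f (Z \<omega>) \<partial>N)) (at_right 0)"
    using Lim_transform_eventually[OF lim eq]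
    by (simp add: expectation_density_proportional[OF N borel_measurable_limit_weight limit_weight_nonneg f])
qed

end

section \<open>Existence of the limit law and conclusion\<close>

text \<open>The witness is the measure with normalised density \<open>g\<close>, with the identity
  as random variable.\<close>

lemma ex_has_density_proportional_to:
  fixes g :: "'b :: euclidean_space \<Rightarrow> real"
  assumes g: "integrable lborel g" and nonneg: "\<And>x. g x \<ge> 0" and pos: "(\<integral>x. g x \<partial>lborel) > 0"
  shows "\<exists>(N :: 'b measure) Z. prob_space N \<and> has_density_proportional_to N Z g"
proof -
  define c where "c = 1 / (\<integral>x. g x \<partial>lborel)"
  have c: "c > 0" using pos by (simp add: c_def)
  have [measurable]: "g \<in> borel_measurable borel" using g by auto
  define N where "N = density lborel (\<lambda>x. ennreal (c * g x))"
  have "emeasure N (space N) = (\<integral>\<^sup>+x. ennreal (c * g x) \<partial>lborel)"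
    by (simp add: N_def emeasure_density)
  also have "\<dots> = ennreal (\<integral>x. c * g x \<partial>lborel)"
    using g c nonneg by (intro nn_integral_eq_integral) auto
  also have "\<dots> = 1" using pos by (simp add: c_def)
  finally have "prob_space N" by (rule prob_spaceI)
  moreover have "distributed N lborel (\<lambda>x. x) (\<lambda>x. ennreal (c * g x))"
    unfolding distributed_def by (auto simp: N_def intro!: distr_id2)
  ultimately show ?thesis
    using c unfolding has_density_proportional_to_def by blast
qed

theorem proposition2p5:
  fixes A :: "real ^ 'p ^ 'n" and y :: "real ^ 'n" and t s0 :: real
    and xhat \<xi> :: "real ^ 'p"
    and M :: "real \<Rightarrow> 'w measure" and X :: "real \<Rightarrow> 'w \<Rightarrow> real ^ 'p"
  assumes "t > 0"
    and "- 1 \<le> s0" and "s0 \<le> 1"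
    and "is_arg_min (lasso_objective A y t) (\<lambda>_. True) xhat"
    and "\<xi> = lasso_xi A y t xhat"
    and "\<And>T. T > 0 \<Longrightarrow> prob_space (M T)"
    and "\<And>T. T > 0 \<Longrightarrow>
           has_density_proportional_to (M T) (X T) (\<lambda>x. exp (- (1 / T) * lasso_objective A y t x))"
    and "invertible_on (supp_set xhat \<union> bdry_zero_set xhat \<xi>)
           (\<lambda>i j. (A *v axis i 1) \<bullet> (A *v axis j 1))"
  shows "(\<exists>(N :: (real ^ 'p) measure) Z.
            prob_space N \<and> has_density_proportional_to N Z (limit_weight s0 A t xhat \<xi>)) \<and>
         (\<forall>(N :: 'v measure) Z.
            prob_space N \<longrightarrow> has_density_proportional_to N Z (limit_weight s0 A t xhat \<xi>) \<longrightarrow>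
            converges_in_distribution M (\<lambda>T \<omega>. rescaled xhat \<xi> T (X T \<omega>)) N Z (at_right 0))"
proof -
  interpret lasso_minimizer A y t xhat \<xi>
    using assms by unfold_locales
  have inv: "invertible_on K (\<lambda>i j. (A *v axis i 1) \<bullet> (A *v axis j 1))"
    using assms by simp
  have "\<exists>(N :: (real ^ 'p) measure) Z.
      prob_space N \<and> has_density_proportional_to N Z (limit_weight s0 A t xhat \<xi>)"
    using integrable_limit_weight[OF inv, of "\<lambda>_. 1" s0] integral_limit_weight_pos[OF inv, of s0]
    by (intro ex_has_density_proportional_to limit_weight_nonneg) auto
  moreover have "\<forall>(N :: 'v measure) Z.
      prob_space N \<longrightarrow> has_density_proportional_to N Z (limit_weight s0 A t xhat \<xi>) \<longrightarrow>
      converges_in_distribution M (\<lambda>T \<omega>. rescaled xhat \<xi> T (X T \<omega>)) N Z (at_right 0)"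
    using converges_rescaled[OF inv assms(6,7)] by blast
  ultimately show ?thesis by blast
qed

end
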